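(* The following hold: (i) $\mathcal{T}(2,n,d) = \{\emptyset\}$ for all $n \ge 2$, $d\ge 1$; (ii) $\mathcal{T}(3,2,1) = \{\{1\}\}$; (iii) $\mathcal{T}(3,n,1) = \{\emptyset, \{1\}\}$ for all $n \ge 3$; (iv) $\mathcal{T}(3,n,d) = \{\emptyset, \{1\}, \{2\}\}$ for all $n \ge 2$ and $d \ge 2$.
   Context: For integers $r\ge 2$, $n \ge 2$, $d\ge 1$, $\mathcal{F}(r,n,d)$ denotes the set of families $F = \{f_1,\dots,f_r\}$ where each $f_j$ is a homogeneous polynomial over $\mathbb{C}$ in $n$ variables of degree $d$, and no two of the $f_j$ are proportional (two polynomials are proportional if one is a complex scalar multiple of the other; in particular all $f_j$ are nonzero). The ticket of $F$ is $T(F) = \{m \in \mathbb{N} : f_1^m,\dots,f_r^m \text{ are linearly dependent over } \mathbb{C}\}$, where $\mathbb{N}$ denotes the positive integers. Finally, $\mathcal{T}(r,n,d) = \{T(F) : F \in \mathcal{F}(r,n,d)\}$. *)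

theory Defs
  imports Complex_Main "HOL-Library.Poly_Mapping"
begin

text \<open>A polynomial is a finitely supported map from monomials to coefficients, a monomial
  being the finitely supported map of its exponents; the product is the convolution product
  of \<^theory>\<open>HOL-Library.Poly_Mapping\<close>. The variables are indexed by natural numbers, and a
  polynomial in n variables is one in which only the variables with index below n occur.\<close>

type_synonym cpoly = "(nat \<Rightarrow>\<^sub>0 nat) \<Rightarrow>\<^sub>0 complex"

definition polys_in :: "nat \<Rightarrow> cpoly set" where
  "polys_in n = {p. \<forall>k \<in> Poly_Mapping.keys p. Poly_Mapping.keys k \<subseteq> {..<n}}"

definition monom_degree :: "(nat \<Rightarrow>\<^sub>0 nat) \<Rightarrow> nat" where
  "monom_degree k = (\<Sum>i \<in> Poly_Mapping.keys k. Poly_Mapping.lookup k i)"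

text \<open>The zero polynomial counts as homogeneous of every degree.\<close>

definition homogeneous :: "nat \<Rightarrow> cpoly \<Rightarrow> bool" where
  "homogeneous d p \<longleftrightarrow> (\<forall>k \<in> Poly_Mapping.keys p. monom_degree k = d)"

definition scale :: "complex \<Rightarrow> cpoly \<Rightarrow> cpoly" where
  "scale c p = Poly_Mapping.map ((*) c) p"

definition proportional :: "cpoly \<Rightarrow> cpoly \<Rightarrow> bool" where
  "proportional p q \<longleftrightarrow> (\<exists>c. p = scale c q) \<or> (\<exists>c. q = scale c p)"

text \<open>A family of r polynomials is given by the values of a function at the indices below r;
  its other values are irrelevant. For r at least 2 all members are nonzero, because 0 is
  proportional to every polynomial.\<close>

definition families :: "nat \<Rightarrow> nat \<Rightarrow> nat \<Rightarrow> (nat \<Rightarrow> cpoly) set" where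
  "families r n d =
    {f. (\<forall>j<r. f j \<in> polys_in n \<and> homogeneous d (f j)) \<and>
        (\<forall>i<r. \<forall>j<r. i \<noteq> j \<longrightarrow> \<not> proportional (f i) (f j))}"

text \<open>Linear dependence of an indexed family, so that a repeated member makes it dependent.\<close>

definition lin_dependent :: "nat \<Rightarrow> (nat \<Rightarrow> cpoly) \<Rightarrow> bool" where
  "lin_dependent r g \<longleftrightarrow>
    (\<exists>c :: nat \<Rightarrow> complex. (\<exists>j<r. c j \<noteq> 0) \<and> (\<Sum>j<r. scale (c j) (g j)) = 0)"

definition ticket :: "nat \<Rightarrow> (nat \<Rightarrow> cpoly) \<Rightarrow> nat set" where
  "ticket r f = {m. m \<ge> 1 \<and> lin_dependent r (\<lambda>j. f j ^ m)}"

definition tickets :: "nat \<Rightarrow> nat \<Rightarrow> nat \<Rightarrow> nat set set" where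
  "tickets r n d = ticket r ` families r n d"

end

theory Submission
  imports Defs "HOL-Computational_Algebra.Polynomial_Factorial"
    "HOL-Computational_Algebra.Field_as_Ring"
begin

text \<open>Two non-proportional polynomials \<open>f\<close>, \<open>g\<close> have independent powers: a relation makes
  \<open>f ^ m\<close> and \<open>g ^ m\<close> divide each other, hence also \<open>f\<close> and \<open>g\<close>, by unique factorization. So in a
  relation among the \<open>m\<close>-th powers of three pairwise non-proportional polynomials all three
  coefficients are nonzero, and the possible tickets are limited by three facts.

  \<^item> The exponent is at most 2. This is Fermat's theorem for polynomials (\<open>fermat_poly\<close>). After
    division by a common factor the three polynomials are pairwise coprime. Eliminating one term
    between the relation and its derivative shows that \<open>h ^ (m - 1)\<close> divides the Wronskian of \<open>f\<close>
    and \<open>g\<close>, which is nonzero of degree less than \<open>deg f + deg g\<close>. The three resulting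
    inequalities add up to \<open>(m - 1) S + 3 \<le> 2 S\<close>, where \<open>S\<close> is the sum of the degrees.

  \<^item> The exponents 1 and 2 do not both occur
    (\<open>linear_and_quadratic_relation_impossible\<close>). Solving the linear relation for \<open>h\<close> and
    substituting into the quadratic one gives a quadratic form in \<open>f\<close> and \<open>g\<close> that vanishes and has
    a nonzero mixed term. It splits into linear factors over the complex numbers, so \<open>f\<close> and \<open>g\<close>
    are proportional.

  \<^item> For linear forms 2 forces 1 (\<open>squares_dependent_imp_linear_forms_dependent\<close>): a relation
    among the squares, read as a relation among symmetric matrices, gives in each row a relation
    among the forms. Hence the ticket of three linear forms is contained in \<open>{1}\<close>. Three linear
    forms in two variables are dependent, so there the ticket is \<open>{1}\<close>.

  Divisibility arguments are made for polynomials in one variable. The Kronecker substitution,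
  which sends the \<open>i\<close>-th variable to \<open>t ^ (N ^ i)\<close>, is a ring homomorphism, and for suitable \<open>N\<close> it
  is injective on the polynomials supported on a given finite set of monomials. It therefore keeps
  the given polynomials non-proportional (\<open>kronecker_preserves_nonproportional\<close>). It destroys
  homogeneity, but the first two facts hold for arbitrary polynomials.

  All values left by these facts occur. For distinct monomials \<open>A\<close>, \<open>B\<close>, \<open>C\<close> of degree \<open>d\<close> the family
  \<open>A, B, C\<close> has the empty ticket, and \<open>A, B, A + B\<close> has the ticket \<open>{1}\<close>. If moreover \<open>A C = B^2\<close>,
  then the Pythagorean family \<open>A - C, 2 B, A + C\<close> has the ticket \<open>{2}\<close>. In degree 1, the
  monomials \<open>A\<close>, \<open>B\<close>, \<open>C\<close> are three variables; from degree 2 on, two variables \<open>x\<close>, \<open>y\<close> suffice: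
  \<open>x^d\<close>, \<open>x^(d-1) y\<close>, \<open>x^(d-2) y^2\<close>.\<close>

section \<open>Relations between powers of univariate polynomials\<close>

definition poly_proportional :: "complex poly \<Rightarrow> complex poly \<Rightarrow> bool" where
  "poly_proportional p q \<longleftrightarrow> (\<exists>c. p = smult c q) \<or> (\<exists>c. q = smult c p)"

lemma poly_proportional_zero [simp]:
  "poly_proportional 0 q" "poly_proportional p 0"
  by (auto simp: poly_proportional_def intro: exI[of _ 0])

lemma poly_proportional_mult_left:
  assumes "poly_proportional p q"
  shows "poly_proportional (r * p) (r * q)"
  using assms by (auto simp: poly_proportional_def)

lemma mutual_dvd_imp_poly_proportional:
  assumes "p dvd q" "q dvd p"
  shows "poly_proportional p q"
proof (cases "p = 0 \<or> q = 0")
  case False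
  obtain r where r: "q = p * r" using assms(1) by blast
  obtain s where s: "p = q * s" using assms(2) by blast
  have "degree q = degree p + degree r" "degree p = degree q + degree s"
    using False r s by (metis degree_mult_eq mult_eq_0_iff)+
  hence "degree r = 0" by simp
  then obtain c where "r = [:c:]" by (metis degree_eq_zeroE)
  thus ?thesis using r by (auto simp: poly_proportional_def)
qed auto

text \<open>Proportional powers divide each other, and in a ring with unique factorization divisibility
  of \<open>m\<close>-th powers passes to their bases.\<close>

lemma poly_proportional_if_powers_proportional:
  fixes f g :: "complex poly"
  assumes "smult a (f ^ m) + smult b (g ^ m) = 0" "a \<noteq> 0 \<or> b \<noteq> 0" "m \<ge> 1"
  shows "poly_proportional f g"
proof (cases "f = 0 \<or> g = 0")
  case False
  have eq: "smult a (f ^ m) = smult (-b) (g ^ m)"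
    using assms(1) by (simp add: add_eq_0_iff)
  have "a \<noteq> 0" "b \<noteq> 0"
    using assms(2) False eq by force+
  have "f ^ m dvd g ^ m"
    using eq \<open>b \<noteq> 0\<close> by (metis dvd_refl dvd_smult dvd_smult_iff neg_equal_0_iff_equal)
  moreover have "g ^ m dvd f ^ m"
    using eq \<open>a \<noteq> 0\<close> by (metis dvd_refl dvd_smult dvd_smult_iff)
  ultimately show ?thesis
    using \<open>m \<ge> 1\<close> by (intro mutual_dvd_imp_poly_proportional) auto
qed auto

definition wronskian :: "complex poly \<Rightarrow> complex poly \<Rightarrow> complex poly" where
  "wronskian f g = f * pderiv g - pderiv f * g"

text \<open>If the Wronskian vanishes, then \<open>f\<close> divides \<open>pderiv f * g\<close>, hence by coprimality its own
  derivative, which has smaller degree; so \<open>f\<close> is constant, and by symmetry so is \<open>g\<close>.\<close>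

lemma wronskian_nonzero:
  assumes "coprime f g" "\<not> poly_proportional f g"
  shows "wronskian f g \<noteq> 0"
proof
  assume "wronskian f g = 0"
  hence eq: "f * pderiv g = pderiv f * g" by (simp add: wronskian_def)
  have "f dvd pderiv f * g" by (metis eq dvd_triv_left)
  hence "f dvd pderiv f" using assms(1) by (simp add: coprime_dvd_mult_left_iff)
  moreover have "g dvd f * pderiv g" by (metis eq dvd_triv_right)
  hence "g dvd pderiv g"
    using assms(1) by (simp add: coprime_dvd_mult_right_iff coprime_commute)
  ultimately have "degree f = 0" "degree g = 0" by auto
  then obtain a b where ab: "f = [:a:]" "g = [:b:]" by (metis degree_eq_zeroE)
  have "poly_proportional f g"
  proof (cases "b = 0")
    case False
    hence "f = smult (a / b) g" by (simp add: ab)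
    thus ?thesis unfolding poly_proportional_def by blast
  qed (simp add: ab)
  with assms(2) show False by contradiction
qed

lemma degree_wronskian:
  assumes "wronskian f g \<noteq> 0"
  shows "degree (wronskian f g) + 1 \<le> degree f + degree g"
proof -
  have pos: "degree f + degree g > 0"
  proof (rule ccontr)
    assume "\<not> ?thesis"
    hence "pderiv f = 0" "pderiv g = 0" by (auto simp: pderiv_eq_0_iff)
    with assms show False by (simp add: wronskian_def)
  qed
  have "degree (f * pderiv g) \<le> degree f + degree g - 1"
  proof (cases "degree g = 0")
    case True
    hence "pderiv g = 0" by (simp add: pderiv_eq_0_iff)
    thus ?thesis by simp
  next
    case False
    thus ?thesis using degree_mult_le[of f "pderiv g"] by (simp add: degree_pderiv)
  qed
  moreover have "degree (pderiv f * g) \<le> degree f + degree g - 1"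
  proof (cases "degree f = 0")
    case True
    hence "pderiv f = 0" by (simp add: pderiv_eq_0_iff)
    thus ?thesis by simp
  next
    case False
    thus ?thesis using degree_mult_le[of "pderiv f" g] by (simp add: degree_pderiv)
  qed
  ultimately have "degree (wronskian f g) \<le> degree f + degree g - 1"
    unfolding wronskian_def by (rule degree_diff_le)
  with pos show ?thesis by linarith
qed

text \<open>Set \<open>F = a f ^ (m - 1)\<close> and likewise \<open>G\<close>, \<open>H\<close>. The relation and its derivative say that
  \<open>(F, G, H)\<close> is orthogonal to \<open>(f, g, h)\<close> and to the derivatives \<open>(f', g', h')\<close>. It is thus
  parallel to their cross product, whose components are the Wronskians. In particular
  \<open>h ^ (m - 1)\<close> divides \<open>f ^ (m - 1)\<close> times the Wronskian of \<open>f\<close> and \<open>g\<close>, and then that Wronskian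
  itself.\<close>

lemma fermat_wronskian_bound:
  fixes f g h :: "complex poly"
  assumes eq: "smult a (f ^ m) + smult b (g ^ m) + smult c (h ^ m) = 0"
    and "a \<noteq> 0" "c \<noteq> 0" "m \<ge> 1"
    and cop: "coprime f g" "coprime h f"
    and np: "\<not> poly_proportional f g"
  shows "(m - 1) * degree h + 1 \<le> degree f + degree g"
proof -
  obtain k where m: "m = Suc k" using \<open>m \<ge> 1\<close> by (cases m) auto
  define F G H where "F = smult a (f ^ k)" and "G = smult b (g ^ k)" and "H = smult c (h ^ k)"
  have e1: "F * f + G * g + H * h = 0"
    using eq by (simp add: F_def G_def H_def m mult.commute)
  have "pderiv (smult a (f ^ m) + smult b (g ^ m) + smult c (h ^ m)) =
      smult (of_nat m) (F * pderiv f + G * pderiv g + H * pderiv h)"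
    by (simp add: m pderiv_add pderiv_smult pderiv_power_Suc F_def G_def H_def smult_add_right ac_simps
             del: power_Suc of_nat_Suc)
  hence e2: "F * pderiv f + G * pderiv g + H * pderiv h = 0"
    using eq m of_nat_neq_0[of k, where ?'a = complex] by (simp del: power_Suc of_nat_Suc)
  \<comment> \<open>Eliminate \<open>G\<close> between the relation and its derivative.\<close>
  have "F * wronskian f g - H * wronskian g h =
     (F * f + G * g + H * h) * pderiv g - (F * pderiv f + G * pderiv g + H * pderiv h) * g"
    by (simp add: wronskian_def algebra_simps)
  hence "F * wronskian f g = H * wronskian g h" by (simp add: e1 e2)
  hence "h ^ k dvd F * wronskian f g" by (simp add: H_def dvd_smult)
  hence "h ^ k dvd f ^ k * wronskian f g"
    using \<open>a \<noteq> 0\<close> by (simp add: F_def dvd_smult_iff)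
  hence dvd: "h ^ k dvd wronskian f g"
    using cop(2) by (simp add: coprime_dvd_mult_right_iff)
  have W: "wronskian f g \<noteq> 0" using wronskian_nonzero[OF cop(1) np] .
  have "degree (h ^ k) \<le> degree (wronskian f g)" using dvd_imp_degree_le[OF dvd W] .
  moreover have "degree (h ^ k) = k * degree h"
    by (cases "h = 0") (auto simp: degree_power_eq power_0_left)
  ultimately show ?thesis using degree_wronskian[OF W] m by simp
qed

text \<open>An \<open>m\<close>-th power of a common divisor of \<open>h\<close> and \<open>f\<close> divides the remaining term, so the divisor
  itself divides \<open>g\<close>.\<close>

lemma fermat_relation_coprime:
  fixes f g h :: "complex poly"
  assumes eq: "smult a (f ^ m) + smult b (g ^ m) + smult c (h ^ m) = 0"
    and "b \<noteq> 0" "m \<ge> 1" "coprime f g"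
  shows "coprime h f"
proof (rule coprimeI)
  fix e assume e: "e dvd h" "e dvd f"
  have "smult b (g ^ m) = - (smult a (f ^ m) + smult c (h ^ m))"
    using eq by (simp add: algebra_simps add_eq_0_iff)
  moreover have "e ^ m dvd f ^ m" "e ^ m dvd h ^ m"
    using e by (auto intro: dvd_power_same)
  ultimately have "e ^ m dvd smult b (g ^ m)" by (simp add: dvd_smult)
  hence "e dvd g" using \<open>b \<noteq> 0\<close> \<open>m \<ge> 1\<close> by (simp add: dvd_smult_iff)
  with e(2) \<open>coprime f g\<close> show "is_unit e" using coprime_common_divisor by blast
qed

text \<open>Fermat's theorem for polynomials, with coefficients and with non-proportionality in place
  of coprimality. Non-proportionality also rules out the constant solutions, as any two
  constants are proportional.\<close>

lemma fermat_poly: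
  fixes f g h :: "complex poly"
  assumes eq: "smult a (f ^ m) + smult b (g ^ m) + smult c (h ^ m) = 0"
    and nz: "a \<noteq> 0" "b \<noteq> 0" "c \<noteq> 0"
    and np: "\<not> poly_proportional f g" "\<not> poly_proportional g h" "\<not> poly_proportional h f"
  shows "m \<le> 2"
proof (rule ccontr)
  assume "\<not> m \<le> 2"
  hence m: "m \<ge> 1" "m \<ge> 3" by auto
  have "gcd f g \<noteq> 0" using np(1) by auto
  define D where "D = gcd f g"
  have D: "D \<noteq> 0" using \<open>gcd f g \<noteq> 0\<close> by (simp add: D_def)
  obtain f0 g0 where fg: "f = f0 * D" "g = g0 * D" "coprime f0 g0"
    using gcd_coprime_exists[OF \<open>gcd f g \<noteq> 0\<close>] D_def by blast
  \<comment> \<open>The greatest common divisor of \<open>f\<close> and \<open>g\<close> also divides \<open>h\<close>, so it can be cancelled.\<close>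
  have "smult c (h ^ m) = - (smult a (f ^ m) + smult b (g ^ m))"
    using eq by (simp add: algebra_simps add_eq_0_iff)
  moreover have "D ^ m dvd f ^ m" "D ^ m dvd g ^ m"
    by (auto simp: D_def intro: dvd_power_same)
  ultimately have "D ^ m dvd smult c (h ^ m)" by (simp add: dvd_smult)
  hence "D dvd h" using nz m by (simp add: dvd_smult_iff)
  then obtain h0 where h: "h = h0 * D" by (metis dvdE mult.commute)
  have "D ^ m * (smult a (f0 ^ m) + smult b (g0 ^ m) + smult c (h0 ^ m)) = 0"
    using eq by (simp add: fg h power_mult_distrib algebra_simps)
  hence eq0: "smult a (f0 ^ m) + smult b (g0 ^ m) + smult c (h0 ^ m) = 0" using D by simp
  hence eq1: "smult b (g0 ^ m) + smult c (h0 ^ m) + smult a (f0 ^ m) = 0"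
    and eq2: "smult c (h0 ^ m) + smult a (f0 ^ m) + smult b (g0 ^ m) = 0"
    by (simp_all add: ac_simps)
  have np0: "\<not> poly_proportional f0 g0" "\<not> poly_proportional g0 h0" "\<not> poly_proportional h0 f0"
    using np poly_proportional_mult_left[of _ _ D] unfolding fg h mult.commute[of _ D] by blast+
  have c1: "coprime h0 f0" using fermat_relation_coprime[OF eq0 nz(2) m(1) fg(3)] .
  have c2: "coprime g0 h0" using fermat_relation_coprime[OF eq2 nz(1) m(1) c1] .
  have "(m - 1) * degree h0 + 1 \<le> degree f0 + degree g0"
    using fermat_wronskian_bound[OF eq0 nz(1,3) m(1) fg(3) c1 np0(1)] .
  moreover have "(m - 1) * degree f0 + 1 \<le> degree g0 + degree h0"
    using fermat_wronskian_bound[OF eq1 nz(2,1) m(1) c2 fg(3) np0(2)] .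
  moreover have "(m - 1) * degree g0 + 1 \<le> degree h0 + degree f0"
    using fermat_wronskian_bound[OF eq2 nz(3,2) m(1) c1 c2 np0(3)] .
  moreover have k: "2 * degree x \<le> (m - 1) * degree x" for x :: "complex poly"
    using m by (intro mult_right_mono) auto
  ultimately show False using k[of f0] k[of g0] k[of h0] by linarith
qed

text \<open>A binary quadratic form over the complex numbers is a product of two linear forms, and in an
  integral domain one of the factors must vanish at \<open>(f, g)\<close>. The hypothesis \<open>B \<noteq> 0\<close> keeps the form from
  being identically zero.\<close>

lemma quadratic_relation_imp_poly_proportional:
  fixes f g :: "complex poly"
  assumes "smult A (f\<^sup>2) + smult B (f * g) + smult C (g\<^sup>2) = 0" "B \<noteq> 0"
  shows "poly_proportional f g"
proof (cases "A = 0")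
  case True
  hence "g * (smult B f + smult C g) = 0"
    using assms(1) by (simp add: algebra_simps power2_eq_square)
  moreover have "f = smult (- C / B) g" if "smult B f + smult C g = 0"
  proof -
    have "smult (inverse B) (smult B f) = smult (inverse B) (smult (- C) g)"
      using that by (simp add: add_eq_0_iff)
    thus ?thesis using assms(2) by (simp add: field_simps)
  qed
  ultimately show ?thesis
    unfolding poly_proportional_def by (metis mult_eq_0_iff smult_0_left)
next
  case False
  \<comment> \<open>The roots of the dehomogenized form are given by the quadratic formula.\<close>
  define s where "s = csqrt (B\<^sup>2 - 4 * A * C)"
  define u where "u = (- B + s) / (2 * A)"
  define v where "v = (- B - s) / (2 * A)"
  have s: "s\<^sup>2 = B\<^sup>2 - 4 * A * C" by (simp add: s_def)
  have "A * (u + v) = - B"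
    using False by (simp add: u_def v_def field_simps)
  moreover have "A * (u * v) = (B\<^sup>2 - s\<^sup>2) / (4 * A)"
    using False by (simp add: u_def v_def field_simps power2_eq_square)
  hence "A * (u * v) = C" using False by (simp add: s)
  ultimately have uv: "A * (u + v) = - B" "A * (u * v) = C" by auto
  have "smult A ((f - smult u g) * (f - smult v g)) =
      smult A (f\<^sup>2) - smult (A * (u + v)) (f * g) + smult (A * (u * v)) (g\<^sup>2)"
    by (intro poly_eqI) (simp add: algebra_simps power2_eq_square)
  also have "\<dots> = 0" using assms(1) by (simp add: uv)
  finally have "f = smult u g \<or> f = smult v g" using False by auto
  thus ?thesis by (auto simp: poly_proportional_def)
qed

section \<open>Reduction to one variable by Kronecker substitution\<close>

text \<open>The exponent of \<open>t\<close> in the image of the monomial \<open>k\<close> when \<open>t ^ (N ^ i)\<close> is substituted for the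
  \<open>i\<close>-th variable.\<close>

definition weight :: "nat \<Rightarrow> (nat \<Rightarrow>\<^sub>0 nat) \<Rightarrow> nat" where
  "weight N k = (\<Sum>i \<in> Poly_Mapping.keys k. Poly_Mapping.lookup k i * N ^ i)"

definition kronecker :: "nat \<Rightarrow> cpoly \<Rightarrow> complex poly" where
  "kronecker N p = (\<Sum>k \<in> Poly_Mapping.keys p. monom (Poly_Mapping.lookup p k) (weight N k))"

lemma lookup_scale [simp]:
  "Poly_Mapping.lookup (scale c p) k = c * Poly_Mapping.lookup p k"
  by (simp add: scale_def Poly_Mapping.map.rep_eq when_def)

lemma keys_scale: "Poly_Mapping.keys (scale c p) \<subseteq> Poly_Mapping.keys p"
  by (auto simp: in_keys_iff)

lemma weight_add: "weight N (k + l) = weight N k + weight N l"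
  unfolding weight_def by (rule setsum_keys_plus_distrib) (auto simp: algebra_simps)

lemma weight_zero [simp]: "weight N 0 = 0"
  by (simp add: weight_def)

lemma kronecker_add: "kronecker N (p + q) = kronecker N p + kronecker N q"
  unfolding kronecker_def by (rule setsum_keys_plus_distrib) (auto simp: add_monom)

lemma kronecker_zero [simp]: "kronecker N 0 = 0"
  by (simp add: kronecker_def)

lemma kronecker_single [simp]:
  "kronecker N (Poly_Mapping.single k c) = monom c (weight N k)"
  by (simp add: kronecker_def)

lemma kronecker_one [simp]: "kronecker N 1 = 1"
  using kronecker_single[of N 0 1] by simp

lemma kronecker_sum: "kronecker N (sum g A) = (\<Sum>x\<in>A. kronecker N (g x))"
  by (induction A rule: infinite_finite_induct) (auto simp: kronecker_add)

text \<open>The index set may exceed the support; this allows a convenient common index set for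
  several polynomials.\<close>

lemma sum_of_monomials:
  fixes p :: "'a \<Rightarrow>\<^sub>0 'b::comm_monoid_add"
  assumes "finite K" "Poly_Mapping.keys p \<subseteq> K"
  shows "(\<Sum>k\<in>K. Poly_Mapping.single k (Poly_Mapping.lookup p k)) = p"
proof (rule poly_mapping_eqI)
  fix l
  have "Poly_Mapping.lookup (\<Sum>k\<in>K. Poly_Mapping.single k (Poly_Mapping.lookup p k)) l =
      (\<Sum>k\<in>K. if k = l then Poly_Mapping.lookup p k else 0)"
    by (simp add: lookup_sum lookup_single when_def)
  also have "\<dots> = Poly_Mapping.lookup p l"
    using assms by (auto simp: sum.delta in_keys_iff)
  finally show "Poly_Mapping.lookup (\<Sum>k\<in>K. Poly_Mapping.single k (Poly_Mapping.lookup p k)) l =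
      Poly_Mapping.lookup p l" .
qed

lemma mult_eq_sum_of_monomials:
  fixes p q :: "'a::monoid_add \<Rightarrow>\<^sub>0 'b::semiring_0"
  assumes "finite K" "Poly_Mapping.keys p \<subseteq> K" "finite L" "Poly_Mapping.keys q \<subseteq> L"
  shows "p * q = (\<Sum>k\<in>K. \<Sum>l\<in>L.
           Poly_Mapping.single (k + l) (Poly_Mapping.lookup p k * Poly_Mapping.lookup q l))"
proof -
  have "p * q = (\<Sum>k\<in>K. Poly_Mapping.single k (Poly_Mapping.lookup p k)) *
                (\<Sum>l\<in>L. Poly_Mapping.single l (Poly_Mapping.lookup q l))"
    by (simp only: sum_of_monomials assms)
  thus ?thesis by (simp add: sum_product mult_single)
qed

lemma kronecker_mult: "kronecker N (p * q) = kronecker N p * kronecker N q"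
proof -
  have "kronecker N (p * q) = (\<Sum>k\<in>Poly_Mapping.keys p. \<Sum>l\<in>Poly_Mapping.keys q.
      monom (Poly_Mapping.lookup p k * Poly_Mapping.lookup q l) (weight N k + weight N l))"
    by (simp add: mult_eq_sum_of_monomials[of "Poly_Mapping.keys p" p "Poly_Mapping.keys q" q]
        kronecker_sum weight_add)
  also have "\<dots> = kronecker N p * kronecker N q"
    by (simp add: kronecker_def sum_product mult_monom)
  finally show ?thesis .
qed

lemma kronecker_power: "kronecker N (p ^ m) = kronecker N p ^ m"
  by (induction m) (auto simp: kronecker_mult)

lemma scale_conv_mult: "scale c p = Poly_Mapping.single 0 c * p"
  by (simp add: scale_def mult_map_scale_conv_mult)

lemma kronecker_scale: "kronecker N (scale c p) = smult c (kronecker N p)"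
  by (simp add: scale_conv_mult kronecker_mult monom_0)

lemmas kronecker_hom = kronecker_add kronecker_mult kronecker_power kronecker_scale

text \<open>The weight of \<open>k\<close> is the value at \<open>N\<close> of the integer polynomial whose coefficients are the
  exponents of \<open>k\<close>. Distinct monomials give distinct polynomials, whose difference has only
  finitely many roots. Any \<open>N\<close> outside the finite set of roots of all these differences
  therefore separates the weights.\<close>

lemma weight_injective:
  assumes "finite K"
  shows "\<exists>N. inj_on (weight N) K"
proof -
  define P :: "(nat \<Rightarrow>\<^sub>0 nat) \<Rightarrow> int poly" where
    "P k = (\<Sum>i\<in>Poly_Mapping.keys k. monom (int (Poly_Mapping.lookup k i)) i)" for k
  have coeff_P: "coeff (P k) i = int (Poly_Mapping.lookup k i)" for k i
    by (auto simp: P_def coeff_sum coeff_monom in_keys_iff)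
  have poly_P: "poly (P k) (int N) = int (weight N k)" for k N
    by (simp add: P_def weight_def poly_sum poly_monom)
  have P_eqD: "k = l" if "P k = P l" for k l
    using that by (metis coeff_P of_nat_eq_iff poly_mapping_eqI)
  define Z where "Z = (\<Union>k\<in>K. \<Union>l\<in>K - {k}. {x. poly (P k - P l) x = 0})"
  have "finite Z"
    unfolding Z_def using assms P_eqD by (intro finite_UN_I finite_Diff poly_roots_finite) auto
  hence "finite (int -` Z)" by (intro finite_vimageI) auto
  then obtain N where N: "N \<notin> int -` Z" using ex_new_if_finite infinite_UNIV_nat by blast
  have "inj_on (weight N) K"
  proof (rule inj_onI, rule ccontr)
    fix k l assume "k \<in> K" "l \<in> K" "weight N k = weight N l" "k \<noteq> l"
    hence "int N \<in> Z" by (auto simp: Z_def poly_P)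
    with N show False by simp
  qed
  thus ?thesis by blast
qed

text \<open>Monomials of distinct weight go to distinct powers of \<open>t\<close>, so nothing can cancel.\<close>

lemma kronecker_injective:
  assumes "inj_on (weight N) K" "Poly_Mapping.keys p \<subseteq> K" "kronecker N p = 0"
  shows "p = 0"
proof (rule ccontr)
  assume "p \<noteq> 0"
  then obtain k where k: "k \<in> Poly_Mapping.keys p" by (metis keys_eq_empty ex_in_conv)
  have "coeff (kronecker N p) (weight N k) =
      (\<Sum>l\<in>Poly_Mapping.keys p. if l = k then Poly_Mapping.lookup p l else 0)"
    unfolding kronecker_def coeff_sum coeff_monom
    using assms(1,2) k by (intro sum.cong refl if_cong) (auto dest: inj_onD)
  also have "\<dots> = Poly_Mapping.lookup p k" using k by (simp add: sum.delta)
  finally show False using k assms(3) by (simp add: in_keys_iff)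
qed

text \<open>The difference of \<open>p\<close> and \<open>c q\<close> is again supported on \<open>K\<close> for every scalar \<open>c\<close>, so a single \<open>N\<close>
  serves for all scalars at once.\<close>

lemma proportional_if_kronecker_proportional:
  assumes inj: "inj_on (weight N) K"
    and keys: "Poly_Mapping.keys p \<subseteq> K" "Poly_Mapping.keys q \<subseteq> K"
    and img: "poly_proportional (kronecker N p) (kronecker N q)"
  shows "proportional p q"
proof -
  have eqI: "r = scale c s"
    if "kronecker N r = smult c (kronecker N s)"
      "Poly_Mapping.keys r \<subseteq> K" "Poly_Mapping.keys s \<subseteq> K" for r s c
  proof -
    have "Poly_Mapping.keys (r + scale (- c) s) \<subseteq> K"
      using that(2,3) keys_add[of r "scale (- c) s"] keys_scale[of "- c" s] by blast
    moreover have "kronecker N (r + scale (- c) s) = 0"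
      by (simp add: kronecker_add kronecker_scale that(1))
    ultimately have "r + scale (- c) s = 0" using kronecker_injective[OF inj] by blast
    hence "Poly_Mapping.lookup r k = c * Poly_Mapping.lookup s k" for k
      by (simp add: poly_mapping_eq_iff fun_eq_iff lookup_add)
    thus ?thesis by (intro poly_mapping_eqI) simp
  qed
  from img show ?thesis
    unfolding poly_proportional_def proportional_def using eqI keys by blast
qed

lemma kronecker_preserves_nonproportional:
  obtains N where "\<And>s t. s \<in> {p, q, r} \<Longrightarrow> t \<in> {p, q, r} \<Longrightarrow> \<not> proportional s t \<Longrightarrow>
    \<not> poly_proportional (kronecker N s) (kronecker N t)"
proof -
  define K where "K = Poly_Mapping.keys p \<union> Poly_Mapping.keys q \<union> Poly_Mapping.keys r"
  obtain N where N: "inj_on (weight N) K"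
    using weight_injective[of K] by (auto simp: K_def)
  have "\<not> poly_proportional (kronecker N s) (kronecker N t)"
    if "s \<in> {p, q, r}" "t \<in> {p, q, r}" "\<not> proportional s t" for s t
    using proportional_if_kronecker_proportional[OF N, of s t] that by (auto simp: K_def)
  thus thesis by (rule that)
qed

section \<open>Relations between powers of pairwise non-proportional polynomials\<close>

lemma nonproportional_powers_independent:
  assumes "\<not> proportional p q" "m \<ge> 1" "scale a (p ^ m) + scale b (q ^ m) = 0"
  shows "a = 0 \<and> b = 0"
proof -
  obtain N where "\<not> poly_proportional (kronecker N p) (kronecker N q)"
    using kronecker_preserves_nonproportional[of p q q] assms(1) by (metis insertCI)
  moreover have "smult a (kronecker N p ^ m) + smult b (kronecker N q ^ m) = 0"
    using arg_cong[OF assms(3), of "kronecker N"] by (simp add: kronecker_hom)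
  ultimately show ?thesis using poly_proportional_if_powers_proportional assms(2) by blast
qed

lemma proportional_commute: "proportional p q \<longleftrightarrow> proportional q p"
  by (auto simp: proportional_def)

lemma scale_zero_left [simp]: "scale 0 p = 0"
  by (intro poly_mapping_eqI) simp

text \<open>A vanishing coefficient would leave a relation between the powers of only two
  polynomials.\<close>

lemma dependent_triple_all_nonzero:
  assumes "\<not> proportional p q" "\<not> proportional q r" "\<not> proportional r p" "m \<ge> 1"
    and eq: "scale a (p ^ m) + scale b (q ^ m) + scale c (r ^ m) = 0"
    and "a \<noteq> 0 \<or> b \<noteq> 0 \<or> c \<noteq> 0"
  shows "a \<noteq> 0" "b \<noteq> 0" "c \<noteq> 0"
proof -
  have "b = 0 \<and> c = 0" if "a = 0"
    using nonproportional_powers_independent[OF assms(2,4), of b c] eq that by simp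
  moreover have "c = 0 \<and> a = 0" if "b = 0"
    using nonproportional_powers_independent[OF assms(3,4), of c a] eq that by (simp add: add.commute)
  moreover have "a = 0 \<and> b = 0" if "c = 0"
    using nonproportional_powers_independent[OF assms(1,4), of a b] eq that by simp
  ultimately show "a \<noteq> 0" "b \<noteq> 0" "c \<noteq> 0" using assms(6) by blast+
qed

lemma dependent_triple_exponent_le_2:
  assumes np: "\<not> proportional p q" "\<not> proportional q r" "\<not> proportional r p" and m: "m \<ge> 1"
    and eq: "scale a (p ^ m) + scale b (q ^ m) + scale c (r ^ m) = 0"
    and nz: "a \<noteq> 0 \<or> b \<noteq> 0 \<or> c \<noteq> 0"
  shows "m \<le> 2"
proof -
  obtain N where np': "\<not> poly_proportional (kronecker N p) (kronecker N q)"
    "\<not> poly_proportional (kronecker N q) (kronecker N r)"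
    "\<not> poly_proportional (kronecker N r) (kronecker N p)"
    using kronecker_preserves_nonproportional[of p q r] np by (metis insertCI)
  have "smult a (kronecker N p ^ m) + smult b (kronecker N q ^ m) + smult c (kronecker N r ^ m) = 0"
    using arg_cong[OF eq, of "kronecker N"] by (simp add: kronecker_hom)
  thus ?thesis
    using fermat_poly[OF _ dependent_triple_all_nonzero[OF np m eq nz] np'] by blast
qed

text \<open>Substituting \<open>h = - (a f + b g) / c\<close> into the quadratic relation produces the mixed term
  \<open>2 c' a b / c^2\<close>, which is nonzero because no coefficient of either relation vanishes.\<close>

lemma linear_and_quadratic_relation_impossible:
  assumes np: "\<not> proportional p q" "\<not> proportional q r" "\<not> proportional r p"
    and lin: "scale a p + scale b q + scale c r = 0" "a \<noteq> 0 \<or> b \<noteq> 0 \<or> c \<noteq> 0"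
    and quad: "scale a' (p\<^sup>2) + scale b' (q\<^sup>2) + scale c' (r\<^sup>2) = 0" "a' \<noteq> 0 \<or> b' \<noteq> 0 \<or> c' \<noteq> 0"
  shows False
proof -
  obtain N where np': "\<not> poly_proportional (kronecker N p) (kronecker N q)"
    using kronecker_preserves_nonproportional[of p q q] np(1) by (metis insertCI)
  have nz: "a \<noteq> 0" "b \<noteq> 0" "c \<noteq> 0" "c' \<noteq> 0"
    using dependent_triple_all_nonzero[OF np, of 1 a b c]
      dependent_triple_all_nonzero[OF np, of 2 a' b' c'] lin quad by simp_all
  define f g h where "f = kronecker N p" and "g = kronecker N q" and "h = kronecker N r"
  have "smult a f + smult b g + smult c h = 0"
    using arg_cong[OF lin(1), of "kronecker N"] by (simp add: kronecker_hom f_def g_def h_def)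
  hence 1: "smult c h = - (smult a f + smult b g)" by (simp add: add_eq_0_iff)
  have 2: "smult a' (f\<^sup>2) + smult b' (g\<^sup>2) + smult c' (h\<^sup>2) = 0"
    using arg_cong[OF quad(1), of "kronecker N"] by (simp add: kronecker_hom f_def g_def h_def)
  \<comment> \<open>Multiplying by \<open>c^2\<close> avoids the division by \<open>c\<close>.\<close>
  have "smult (c\<^sup>2) (smult a' (f\<^sup>2) + smult b' (g\<^sup>2) + smult c' (h\<^sup>2)) =
      smult (c\<^sup>2 * a') (f\<^sup>2) + smult (c\<^sup>2 * b') (g\<^sup>2) + smult c' ((smult c h)\<^sup>2)"
    by (simp add: smult_add_right smult_power mult_ac)
  also have "\<dots> = smult (c\<^sup>2 * a' + c' * a\<^sup>2) (f\<^sup>2) + smult (c' * a * b + c' * a * b) (f * g) +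
      smult (c\<^sup>2 * b' + c' * b\<^sup>2) (g\<^sup>2)"
    unfolding 1 power2_minus
    by (simp only: power2_eq_square distrib_left distrib_right mult_smult_left mult_smult_right
        smult_smult smult_add_left smult_add_right ac_simps)
  finally have rel: "smult (c\<^sup>2 * a' + c' * a\<^sup>2) (f\<^sup>2) + smult (c' * a * b + c' * a * b) (f * g) +
      smult (c\<^sup>2 * b' + c' * b\<^sup>2) (g\<^sup>2) = 0" unfolding 2 by simp
  have "c' * a * b + c' * a * b \<noteq> 0" using nz by (simp flip: mult_2)
  hence "poly_proportional f g" by (rule quadratic_relation_imp_poly_proportional[OF rel])
  with np' show False by (simp add: f_def g_def)
qed

section \<open>Linear forms\<close>

definition var :: "nat \<Rightarrow> (nat \<Rightarrow>\<^sub>0 nat)" where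
  "var i = Poly_Mapping.single i 1"

lemma lookup_var: "Poly_Mapping.lookup (var i) j = (if i = j then 1 else 0)"
  by (simp add: var_def lookup_single when_def)

lemma keys_var [simp]: "Poly_Mapping.keys (var i) = {i}"
  by (simp add: var_def)

lemma inj_var: "inj var"
  by (rule injI) (metis lookup_var zero_neq_one)

lemma monom_degree_add: "monom_degree (k + l) = monom_degree k + monom_degree l"
  unfolding monom_degree_def by (rule setsum_keys_plus_distrib) auto

lemma monom_degree_single [simp]: "monom_degree (Poly_Mapping.single i a) = a"
  by (simp add: monom_degree_def)

lemma monom_degree_1E:
  assumes "monom_degree k = 1"
  obtains i where "k = var i"
proof -
  obtain i where i: "i \<in> Poly_Mapping.keys k"
    "Poly_Mapping.lookup k i = 1" "\<forall>j\<in>Poly_Mapping.keys k. i \<noteq> j \<longrightarrow> Poly_Mapping.lookup k j = 0"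
    using assms unfolding monom_degree_def by (subst (asm) sum_eq_1_iff) auto
  have "k = var i"
    using i by (intro poly_mapping_eqI) (auto simp: lookup_var in_keys_iff)
  thus thesis by (rule that)
qed

lemma lookup_linear_eq_0:
  assumes "homogeneous 1 p" "\<And>i. k \<noteq> var i"
  shows "Poly_Mapping.lookup p k = 0"
  using assms monom_degree_1E unfolding homogeneous_def by (metis in_keys_iff)

lemma var_add_eq_iff:
  "var i + var j = var a + var b \<longleftrightarrow> i = a \<and> j = b \<or> i = b \<and> j = a"
proof
  assume eq: "var i + var j = var a + var b"
  have "(if i = l then 1 else 0) + (if j = l then 1 else 0) =
        (if a = l then 1 else 0) + (if b = l then 1 else (0::nat))" for l
    using arg_cong[OF eq, of "\<lambda>k. Poly_Mapping.lookup k l"]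
    by (simp only: lookup_add lookup_var)
  from this[of i] this[of j] show "i = a \<and> j = b \<or> i = b \<and> j = a"
    by (cases "i = a"; cases "i = b"; cases "j = a"; cases "j = b"; cases "i = j"; simp)
qed (auto simp: add.commute)

text \<open>Up to the factor 2 off the diagonal, the coefficients of the square are the entries of the
  rank-one symmetric matrix \<open>u u^T\<close>, where \<open>u\<close> is the coefficient vector of \<open>p\<close>.\<close>

lemma lookup_square_linear:
  assumes "homogeneous 1 p"
  shows "Poly_Mapping.lookup (p\<^sup>2) (var a + var b) =
    (if a = b then 1 else 2) * (Poly_Mapping.lookup p (var a) * Poly_Mapping.lookup p (var b))"
proof -
  define u where "u i = Poly_Mapping.lookup p (var i)" for i
  \<comment> \<open>Adding \<open>a\<close> and \<open>b\<close> ensures that both index pairs below lie in \<open>I \<times> I\<close>.\<close>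
  define I where "I = {i. var i \<in> Poly_Mapping.keys p} \<union> {a, b}"
  have "finite I" unfolding I_def
    using finite_vimageI[OF finite_keys inj_var, of p] by (simp add: vimage_def)
  have "Poly_Mapping.keys p \<subseteq> var ` I"
    using assms monom_degree_1E unfolding homogeneous_def I_def by blast
  hence "p * p = (\<Sum>k\<in>var ` I. \<Sum>l\<in>var ` I.
           Poly_Mapping.single (k + l) (Poly_Mapping.lookup p k * Poly_Mapping.lookup p l))"
    using \<open>finite I\<close> by (intro mult_eq_sum_of_monomials) auto
  also have "\<dots> = (\<Sum>i\<in>I. \<Sum>j\<in>I. Poly_Mapping.single (var i + var j) (u i * u j))"
    using inj_var by (simp add: sum.reindex inj_on_def u_def)
  finally have "Poly_Mapping.lookup (p\<^sup>2) (var a + var b) =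
      (\<Sum>i\<in>I. \<Sum>j\<in>I. if i = a \<and> j = b \<or> i = b \<and> j = a then u i * u j else 0)"
    by (simp add: power2_eq_square lookup_sum lookup_single when_def var_add_eq_iff)
  also have "\<dots> = (\<Sum>(i, j)\<in>I \<times> I. if (i, j) \<in> {(a, b), (b, a)} then u i * u j else 0)"
    by (simp add: sum.cartesian_product)
  also have "\<dots> = (\<Sum>(i, j)\<in>{(a, b), (b, a)}. u i * u j)"
    using \<open>finite I\<close> by (intro sum.mono_neutral_cong_right) (auto simp: I_def split: if_splits)
  also have "\<dots> = (if a = b then 1 else 2) * (u a * u b)"
    by (simp add: mult.commute)
  finally show ?thesis by (simp add: u_def)
qed

text \<open>With \<open>u\<close>, \<open>v\<close>, \<open>w\<close> the coefficient vectors of the forms, the hypothesis says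
  \<open>a u u^T + b v v^T + c w w^T = 0\<close>. Row \<open>i\<close> of this matrix equation is the linear relation with
  coefficients \<open>a u_i\<close>, \<open>b v_i\<close>, \<open>c w_i\<close>, and it is nontrivial when \<open>u_i \<noteq> 0\<close>.\<close>

lemma squares_dependent_imp_linear_forms_dependent:
  assumes hom: "homogeneous 1 p" "homogeneous 1 q" "homogeneous 1 r"
    and "p \<noteq> 0" "a \<noteq> 0"
    and eq: "scale a (p\<^sup>2) + scale b (q\<^sup>2) + scale c (r\<^sup>2) = 0"
  obtains a' b' c' where "a' \<noteq> 0" "scale a' p + scale b' q + scale c' r = 0"
proof -
  let ?c = "\<lambda>s i. Poly_Mapping.lookup s (var i)"
  obtain k where "Poly_Mapping.lookup p k \<noteq> 0" using \<open>p \<noteq> 0\<close> by (metis lookup_zero poly_mapping_eqI)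
  then obtain i where i: "?c p i \<noteq> 0" using lookup_linear_eq_0[OF hom(1)] by metis
  have polar: "a * ?c p i * ?c p j + b * ?c q i * ?c q j + c * ?c r i * ?c r j = 0" for j
  proof -
    define w :: complex where "w = (if i = j then 1 else 2)"
    have "w * (a * ?c p i * ?c p j + b * ?c q i * ?c q j + c * ?c r i * ?c r j) =
      Poly_Mapping.lookup (scale a (p\<^sup>2) + scale b (q\<^sup>2) + scale c (r\<^sup>2)) (var i + var j)"
      unfolding lookup_add lookup_scale lookup_square_linear[OF hom(1)]
        lookup_square_linear[OF hom(2)] lookup_square_linear[OF hom(3)] w_def[symmetric]
      by (simp only: algebra_simps)
    moreover have "w \<noteq> 0" by (simp add: w_def)
    ultimately show ?thesis by (simp add: eq)
  qed
  have "scale (a * ?c p i) p + scale (b * ?c q i) q + scale (c * ?c r i) r = 0"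
  proof (rule poly_mapping_eqI)
    fix k
    show "Poly_Mapping.lookup (scale (a * ?c p i) p + scale (b * ?c q i) q + scale (c * ?c r i) r) k =
        Poly_Mapping.lookup 0 k"
    proof (cases "\<exists>j. k = var j")
      case True
      thus ?thesis using polar by (auto simp: lookup_add)
    next
      case False
      thus ?thesis using hom by (simp add: lookup_add lookup_linear_eq_0)
    qed
  qed
  thus thesis using that i \<open>a \<noteq> 0\<close> by (metis mult_eq_0_iff)
qed

text \<open>Two equations in three unknowns are solved by the cross product of the two coefficient
  rows. Its last component is the determinant of \<open>p\<close> and \<open>q\<close>, which is nonzero as they are not
  proportional.\<close>

lemma three_binary_linear_forms_dependent:
  assumes hom: "homogeneous 1 p" "homogeneous 1 q" "homogeneous 1 r"
    and vars: "p \<in> polys_in 2" "q \<in> polys_in 2" "r \<in> polys_in 2"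
    and np: "\<not> proportional p q"
  obtains a b c where "c \<noteq> 0" "scale a p + scale b q + scale c r = 0"
proof -
  let ?c = "\<lambda>s i. Poly_Mapping.lookup s (var i)"
  have zero: "Poly_Mapping.lookup s k = 0"
    if s: "homogeneous 1 s" "s \<in> polys_in 2" "k \<noteq> var 0" "k \<noteq> var 1" for s k
  proof (rule ccontr)
    assume *: "Poly_Mapping.lookup s k \<noteq> 0"
    then obtain i where i: "k = var i" using lookup_linear_eq_0 s(1) by blast
    hence "var i \<in> Poly_Mapping.keys s" using * by (simp add: in_keys_iff)
    hence "i < 2" using s(2) by (fastforce simp: polys_in_def)
    with s(3,4) i show False by (auto simp: less_2_cases_iff)
  qed
  have eqI: "s = 0" if "?c s 0 = 0" "?c s 1 = 0"
    "\<And>k. k \<noteq> var 0 \<Longrightarrow> k \<noteq> var 1 \<Longrightarrow> Poly_Mapping.lookup s k = 0" for s :: cpoly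
    using that by (intro poly_mapping_eqI) (metis lookup_zero)
  define a where "a = ?c q 0 * ?c r 1 - ?c q 1 * ?c r 0"
  define b where "b = ?c r 0 * ?c p 1 - ?c r 1 * ?c p 0"
  define c where "c = ?c p 0 * ?c q 1 - ?c p 1 * ?c q 0"
  have "scale a p + scale b q + scale c r = 0"
    using zero hom vars
    by (intro eqI) (simp_all add: lookup_add a_def b_def c_def algebra_simps)
  moreover have "c \<noteq> 0"
  proof
    assume "c = 0"
    \<comment> \<open>If the determinant vanishes, each coordinate yields a relation between \<open>p\<close> and \<open>q\<close>.\<close>
    have rel: "scale (?c q i) p + scale (- ?c p i) q = 0" if "i = 0 \<or> i = 1" for i
      using zero hom vars \<open>c = 0\<close> that
      by (intro eqI) (auto simp: lookup_add c_def algebra_simps)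
    have "?c p i = 0 \<and> ?c q i = 0" if "i = 0 \<or> i = 1" for i
      using nonproportional_powers_independent[OF np, of 1] rel[OF that] by fastforce
    hence "p = 0" using zero hom vars by (intro eqI) auto
    hence "p = scale 0 q" by simp
    with np show False unfolding proportional_def by blast
  qed
  ultimately show thesis by (rule that[rotated])
qed

section \<open>Upper bounds on the tickets\<close>

lemma lin_dependent_2_iff:
  "lin_dependent 2 g \<longleftrightarrow> (\<exists>a b. (a \<noteq> 0 \<or> b \<noteq> 0) \<and> scale a (g 0) + scale b (g 1) = 0)"
proof
  assume "lin_dependent 2 g"
  then obtain c :: "nat \<Rightarrow> complex" where c: "\<exists>j<2. c j \<noteq> 0" "(\<Sum>j<2. scale (c j) (g j)) = 0"
    unfolding lin_dependent_def by blast
  have "c 0 \<noteq> 0 \<or> c 1 \<noteq> 0" using c(1) less_2_cases by fastforce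
  moreover have "scale (c 0) (g 0) + scale (c 1) (g 1) = 0"
    using c(2) by (simp add: numeral_2_eq_2)
  ultimately show "\<exists>a b. (a \<noteq> 0 \<or> b \<noteq> 0) \<and> scale a (g 0) + scale b (g 1) = 0" by blast
next
  assume "\<exists>a b. (a \<noteq> 0 \<or> b \<noteq> 0) \<and> scale a (g 0) + scale b (g 1) = 0"
  then obtain a b where "a \<noteq> 0 \<or> b \<noteq> 0" "scale a (g 0) + scale b (g 1) = 0" by blast
  thus "lin_dependent 2 g"
    unfolding lin_dependent_def
    by (intro exI[of _ "\<lambda>j. if j = 0 then a else b"]) (auto simp: numeral_2_eq_2)
qed

lemma lin_dependent_3_iff:
  "lin_dependent 3 g \<longleftrightarrow> (\<exists>a b c. (a \<noteq> 0 \<or> b \<noteq> 0 \<or> c \<noteq> 0) \<and>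
     scale a (g 0) + scale b (g 1) + scale c (g 2) = 0)"
proof
  assume "lin_dependent 3 g"
  then obtain c :: "nat \<Rightarrow> complex" where c: "\<exists>j<3. c j \<noteq> 0" "(\<Sum>j<3. scale (c j) (g j)) = 0"
    unfolding lin_dependent_def by blast
  have "c 0 \<noteq> 0 \<or> c 1 \<noteq> 0 \<or> c 2 \<noteq> 0"
    using c(1) by (auto simp: less_Suc_eq eval_nat_numeral)
  moreover have "scale (c 0) (g 0) + scale (c 1) (g 1) + scale (c 2) (g 2) = 0"
    using c(2) by (simp add: eval_nat_numeral)
  ultimately show "\<exists>a b c. (a \<noteq> 0 \<or> b \<noteq> 0 \<or> c \<noteq> 0) \<and>
     scale a (g 0) + scale b (g 1) + scale c (g 2) = 0" by blast
next
  assume "\<exists>a b c. (a \<noteq> 0 \<or> b \<noteq> 0 \<or> c \<noteq> 0) \<and>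
     scale a (g 0) + scale b (g 1) + scale c (g 2) = 0"
  then obtain a b c where abc: "a \<noteq> 0 \<or> b \<noteq> 0 \<or> c \<noteq> 0"
    "scale a (g 0) + scale b (g 1) + scale c (g 2) = 0" by blast
  define d where "d j = (if j = 0 then a else if j = 1 then b else c)" for j :: nat
  have "d 0 \<noteq> 0 \<or> d 1 \<noteq> 0 \<or> d 2 \<noteq> 0" using abc(1) by (auto simp: d_def)
  moreover have "(0::nat) < 3" "(1::nat) < 3" "(2::nat) < 3" by auto
  ultimately have "\<exists>j<3. d j \<noteq> 0" by blast
  moreover have "(\<Sum>j<3. scale (d j) (g j)) = 0"
    using abc(2) by (simp add: d_def eval_nat_numeral)
  ultimately show "lin_dependent 3 g" unfolding lin_dependent_def by blast
qed

lemma ticket_2_empty: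
  assumes "f \<in> families 2 n d"
  shows "ticket 2 f = {}"
proof -
  have "\<not> proportional (f 0) (f 1)" using assms by (auto simp: families_def)
  thus ?thesis
    using nonproportional_powers_independent by (auto simp: ticket_def lin_dependent_2_iff)
qed

lemma families_3_nonproportional:
  assumes "f \<in> families 3 n d"
  shows "\<not> proportional (f 0) (f 1)" "\<not> proportional (f 1) (f 2)" "\<not> proportional (f 2) (f 0)"
  using assms by (auto simp: families_def)

lemma ticket_3_cases:
  assumes "f \<in> families 3 n d"
  shows "ticket 3 f \<in> {{}, {1}, {2}}"
proof -
  note np = families_3_nonproportional[OF assms]
  have "ticket 3 f \<subseteq> {1, 2}"
  proof
    fix m assume "m \<in> ticket 3 f"
    hence "m \<ge> 1" "m \<le> 2"
      using dependent_triple_exponent_le_2[OF np] by (auto simp: ticket_def lin_dependent_3_iff)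
    thus "m \<in> {1, 2}" by auto
  qed
  moreover have "\<not> (1 \<in> ticket 3 f \<and> 2 \<in> ticket 3 f)"
    using linear_and_quadratic_relation_impossible[OF np] unfolding ticket_def lin_dependent_3_iff mem_Collect_eq power_one_right
    by metis
  ultimately show ?thesis by blast
qed

lemma linear_ticket_3_cases:
  assumes "f \<in> families 3 n 1"
  shows "ticket 3 f \<in> {{}, {1}}"
proof -
  note np = families_3_nonproportional[OF assms]
  have hom: "homogeneous 1 (f 0)" "homogeneous 1 (f 1)" "homogeneous 1 (f 2)"
    using assms by (auto simp: families_def)
  have "1 \<in> ticket 3 f" if "2 \<in> ticket 3 f"
  proof -
    obtain a b c where abc: "a \<noteq> 0 \<or> b \<noteq> 0 \<or> c \<noteq> 0"
      "scale a ((f 0)\<^sup>2) + scale b ((f 1)\<^sup>2) + scale c ((f 2)\<^sup>2) = 0"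
      using \<open>2 \<in> ticket 3 f\<close> by (auto simp: ticket_def lin_dependent_3_iff)
    have "a \<noteq> 0" using dependent_triple_all_nonzero(1)[OF np, of 2 a b c] abc by simp
    moreover have "f 0 \<noteq> 0"
      using np(1) unfolding proportional_def by (metis scale_zero_left)
    ultimately obtain a' b' c' where
      "a' \<noteq> 0" "scale a' (f 0) + scale b' (f 1) + scale c' (f 2) = 0"
      using squares_dependent_imp_linear_forms_dependent[OF hom] abc(2) by metis
    thus ?thesis by (auto simp: ticket_def lin_dependent_3_iff)
  qed
  with ticket_3_cases[OF assms] show ?thesis by auto
qed

lemma binary_linear_ticket_3:
  assumes "f \<in> families 3 2 1"
  shows "ticket 3 f = {1}"
proof -
  have hom: "homogeneous 1 (f 0)" "homogeneous 1 (f 1)" "homogeneous 1 (f 2)"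
    and vars: "f 0 \<in> polys_in 2" "f 1 \<in> polys_in 2" "f 2 \<in> polys_in 2"
    using assms by (auto simp: families_def)
  obtain a b c where "c \<noteq> 0" "scale a (f 0) + scale b (f 1) + scale c (f 2) = 0"
    using three_binary_linear_forms_dependent[OF hom vars families_3_nonproportional(1)[OF assms]] .
  hence "1 \<in> ticket 3 f" by (auto simp: ticket_def lin_dependent_3_iff)
  with linear_ticket_3_cases[OF assms] show ?thesis by auto
qed

section \<open>Families with prescribed tickets\<close>

text \<open>The coefficient rows of proportional polynomials have vanishing two-by-two minors.\<close>

lemma not_proportionalI:
  assumes "Poly_Mapping.lookup p k * Poly_Mapping.lookup q l \<noteq>
    Poly_Mapping.lookup p l * Poly_Mapping.lookup q k"
  shows "\<not> proportional p q"
  using assms by (auto simp: proportional_def)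

definition form_monomials :: "nat \<Rightarrow> nat \<Rightarrow> (nat \<Rightarrow>\<^sub>0 nat) set" where
  "form_monomials n d = {k. Poly_Mapping.keys k \<subseteq> {..<n} \<and> monom_degree k = d}"

lemma form_iff:
  "p \<in> polys_in n \<and> homogeneous d p \<longleftrightarrow> Poly_Mapping.keys p \<subseteq> form_monomials n d"
  by (auto simp: polys_in_def homogeneous_def form_monomials_def)

text \<open>Only the values at 0, 1 and 2 matter; \<open>triple p q q\<close> also serves as a family of two.\<close>

definition triple :: "cpoly \<Rightarrow> cpoly \<Rightarrow> cpoly \<Rightarrow> nat \<Rightarrow> cpoly" where
  "triple p q r j = (if j = 0 then p else if j = 1 then q else r)"

lemma triple_simps [simp]: "triple p q r 0 = p" "triple p q r 1 = q" "triple p q r (Suc 0) = q" "triple p q r 2 = r"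
  by (simp_all add: triple_def)

lemma triple_in_families:
  assumes "Poly_Mapping.keys p \<subseteq> form_monomials n d" "Poly_Mapping.keys q \<subseteq> form_monomials n d"
    "Poly_Mapping.keys r \<subseteq> form_monomials n d"
    and "\<not> proportional p q" "\<not> proportional q r" "\<not> proportional r p"
  shows "triple p q r \<in> families 3 n d"
  using assms unfolding families_def triple_def
  by (auto simp: form_iff[symmetric] proportional_commute less_Suc_eq eval_nat_numeral)

lemma pair_in_families:
  assumes "Poly_Mapping.keys p \<subseteq> form_monomials n d" "Poly_Mapping.keys q \<subseteq> form_monomials n d"
    and "\<not> proportional p q"
  shows "triple p q q \<in> families 2 n d"
  using assms unfolding families_def triple_def
  by (auto simp: form_iff[symmetric] proportional_commute less_Suc_eq eval_nat_numeral)

lemma single_not_proportional: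
  assumes "k \<noteq> l"
  shows "\<not> proportional (Poly_Mapping.single k 1) (Poly_Mapping.single l 1)"
  using assms by (intro not_proportionalI[where k = k and l = l]) (auto simp: lookup_single when_def)

lemma monomials_independent:
  assumes "k \<noteq> l" "l \<noteq> j" "j \<noteq> k"
    and eq: "scale a (Poly_Mapping.single k 1) + scale b (Poly_Mapping.single l 1) +
      scale c (Poly_Mapping.single j 1) = 0"
  shows "a = 0 \<and> b = 0 \<and> c = 0"
proof -
  have "a * (1 when k = t) + b * (1 when l = t) + c * (1 when j = t) = 0" for t
    using arg_cong[OF eq, of "\<lambda>p. Poly_Mapping.lookup p t"] by (simp add: lookup_add lookup_single)
  from this[of k] this[of l] this[of j] show ?thesis using assms(1-3) by (auto simp: when_def)
qed

lemma monomial_double_injective: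
  fixes k l :: "nat \<Rightarrow>\<^sub>0 nat"
  assumes "k + k = l + l"
  shows "k = l"
proof (rule poly_mapping_eqI)
  fix i
  show "Poly_Mapping.lookup k i = Poly_Mapping.lookup l i"
    using arg_cong[OF assms, of "\<lambda>t. Poly_Mapping.lookup t i"] by (simp add: lookup_add)
qed

text \<open>Three monomials have the empty ticket: only the exponents 1 and 2 have to be examined, and the squares of distinct
  monomials are again distinct monomials.\<close>

lemma empty_ticket_exists:
  assumes "k \<in> form_monomials n d" "l \<in> form_monomials n d" "j \<in> form_monomials n d"
    and dist: "k \<noteq> l" "l \<noteq> j" "j \<noteq> k"
  shows "{} \<in> tickets 3 n d"
proof -
  define f where "f = triple (Poly_Mapping.single k 1) (Poly_Mapping.single l 1) (Poly_Mapping.single j 1)"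
  have f: "f \<in> families 3 n d"
    unfolding f_def using assms by (intro triple_in_families single_not_proportional) auto
  have not_1: "1 \<notin> ticket 3 f"
    unfolding ticket_def lin_dependent_3_iff f_def using monomials_independent[OF dist] by auto
  have sq: "Poly_Mapping.single i (1::complex) ^ 2 = Poly_Mapping.single (i + i) 1" for i :: "nat \<Rightarrow>\<^sub>0 nat"
    by (simp add: power2_eq_square mult_single)
  have "k + k \<noteq> l + l" "l + l \<noteq> j + j" "j + j \<noteq> k + k"
    using dist monomial_double_injective by blast+
  hence not_2: "2 \<notin> ticket 3 f"
    unfolding ticket_def lin_dependent_3_iff f_def mem_Collect_eq triple_simps sq
    using monomials_independent by blast
  have "ticket 3 f = {}" using ticket_3_cases[OF f] not_1 not_2 by auto
  thus ?thesis unfolding tickets_def using f by (metis image_eqI)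
qed

text \<open>The family \<open>p, q, p + q\<close>. Containing 1 is enough, as a ticket has at most one element.\<close>

lemma ticket_one_exists:
  assumes "k \<in> form_monomials n d" "l \<in> form_monomials n d" "k \<noteq> l"
  shows "{1} \<in> tickets 3 n d"
proof -
  define p q :: cpoly where "p = Poly_Mapping.single k 1" and "q = Poly_Mapping.single l 1"
  have look: "Poly_Mapping.lookup p k = 1" "Poly_Mapping.lookup p l = 0"
    "Poly_Mapping.lookup q k = 0" "Poly_Mapping.lookup q l = 1"
    using assms(3) by (auto simp: p_def q_def lookup_single when_def)
  have keys: "Poly_Mapping.keys p \<subseteq> form_monomials n d" "Poly_Mapping.keys q \<subseteq> form_monomials n d"
    using assms by (auto simp: p_def q_def)
  have f: "triple p q (p + q) \<in> families 3 n d"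
    using keys keys_add[of p q]
    by (intro triple_in_families not_proportionalI[where k = k and l = l]) (auto simp: look lookup_add)
  have "scale 1 p + scale 1 q + scale (-1) (p + q) = 0"
    by (intro poly_mapping_eqI) (simp add: lookup_add)
  hence "1 \<in> ticket 3 (triple p q (p + q))"
    unfolding ticket_def lin_dependent_3_iff mem_Collect_eq triple_simps power_one_right
    using one_neq_zero by blast
  hence "ticket 3 (triple p q (p + q)) = {1}" using ticket_3_cases[OF f] by auto
  thus ?thesis unfolding tickets_def using f by (metis image_eqI)
qed

text \<open>The Pythagorean identity \<open>(A - C)^2 + (2 B)^2 = (A + C)^2\<close> holds for monomials with
  \<open>A C = B^2\<close>; this is the condition \<open>k + j = l + l\<close> on the exponents.\<close>

lemma ticket_two_exists:
  assumes mono: "k \<in> form_monomials n d" "l \<in> form_monomials n d" "j \<in> form_monomials n d"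
    and dist: "k \<noteq> l" "l \<noteq> j" "j \<noteq> k"
    and progression: "k + j = l + l"
  shows "{2} \<in> tickets 3 n d"
proof -
  define A B C :: cpoly where "A = Poly_Mapping.single k 1" and "B = Poly_Mapping.single l 1"
    and "C = Poly_Mapping.single j 1"
  define p q r where "p = A - C" and "q = B + B" and "r = A + C"
  have keysABC: "Poly_Mapping.keys A \<subseteq> form_monomials n d" "Poly_Mapping.keys B \<subseteq> form_monomials n d"
      "Poly_Mapping.keys C \<subseteq> form_monomials n d"
    using mono by (auto simp: A_def B_def C_def)
  have keys: "Poly_Mapping.keys p \<subseteq> form_monomials n d" "Poly_Mapping.keys q \<subseteq> form_monomials n d"
      "Poly_Mapping.keys r \<subseteq> form_monomials n d"
    using keysABC keys_diff[of A C] keys_add[of B B] keys_add[of A C] unfolding p_def q_def r_def by blast+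
  have look_q: "Poly_Mapping.lookup q t = 2 * Poly_Mapping.lookup B t" for t
    by (simp only: q_def lookup_add mult_2)
  have look: "Poly_Mapping.lookup p k = 1" "Poly_Mapping.lookup p l = 0" "Poly_Mapping.lookup p j = -1"
     "Poly_Mapping.lookup q k = 0" "Poly_Mapping.lookup q l = 2" "Poly_Mapping.lookup q j = 0"
     "Poly_Mapping.lookup r k = 1" "Poly_Mapping.lookup r l = 0" "Poly_Mapping.lookup r j = 1"
    using dist by (auto simp: p_def look_q r_def A_def B_def C_def lookup_add lookup_minus lookup_single when_def)
  have "\<not> proportional p q" "\<not> proportional q r"
    by (rule not_proportionalI[where k = k and l = l], simp add: look)+
  moreover have "\<not> proportional r p"
    by (rule not_proportionalI[where k = k and l = j]) (simp add: look)
  ultimately have f: "triple p q r \<in> families 3 n d"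
    using keys by (intro triple_in_families)
  have "A * C = B * B"
    by (simp add: A_def B_def C_def mult_single progression)
  moreover have "p\<^sup>2 + q\<^sup>2 - r\<^sup>2 = 4 * (B * B - A * C)"
    by (simp add: p_def q_def r_def power2_eq_square algebra_simps)
  ultimately have sq: "p\<^sup>2 + q\<^sup>2 = r\<^sup>2" by simp
  have "scale 1 (p\<^sup>2) + scale 1 (q\<^sup>2) + scale (-1) (r\<^sup>2) = 0"
    unfolding sq[symmetric] by (intro poly_mapping_eqI) (simp add: lookup_add)
  hence "2 \<in> ticket 3 (triple p q r)"
    unfolding ticket_def lin_dependent_3_iff mem_Collect_eq triple_simps
    using one_neq_zero one_le_numeral by blast
  hence "ticket 3 (triple p q r) = {2}" using ticket_3_cases[OF f]
    by (metis empty_iff insertE numeral_eq_one_iff semiring_norm(85))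
  thus ?thesis unfolding tickets_def using f by (metis image_eqI)
qed

lemma pure_power_in_form_monomials:
  assumes "i < n"
  shows "Poly_Mapping.single i d \<in> form_monomials n d"
  using assms by (auto simp: form_monomials_def)

lemma binary_monomial_in_form_monomials:
  assumes "n \<ge> 2" "a + b = d"
  shows "Poly_Mapping.single 0 a + Poly_Mapping.single 1 b \<in> form_monomials n d"
  using assms keys_add[of "Poly_Mapping.single 0 a" "Poly_Mapping.single (1::nat) b"]
  by (auto simp: form_monomials_def monom_degree_add split: if_splits)

lemma binary_monomial_eq_iff:
  "Poly_Mapping.single (0::nat) a + Poly_Mapping.single 1 b =
   Poly_Mapping.single 0 a' + Poly_Mapping.single 1 b' \<longleftrightarrow> a = a' \<and> b = (b'::nat)"
proof
  assume eq: "Poly_Mapping.single (0::nat) a + Poly_Mapping.single 1 b =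
    Poly_Mapping.single 0 a' + Poly_Mapping.single 1 b'"
  from arg_cong[OF eq, of "\<lambda>k. Poly_Mapping.lookup k 0"] arg_cong[OF eq, of "\<lambda>k. Poly_Mapping.lookup k 1"]
  show "a = a' \<and> b = b'" by (simp add: lookup_add lookup_single)
qed auto

section \<open>The sets of tickets of two and of three forms\<close>

theorem theorem3:
  shows "(\<forall>n d :: nat. n \<ge> 2 \<and> d \<ge> 1 \<longrightarrow> tickets 2 n d = {{}})
    \<and> tickets 3 2 1 = {{1}}
    \<and> (\<forall>n :: nat. n \<ge> 3 \<longrightarrow> tickets 3 n 1 = {{}, {1}})
    \<and> (\<forall>n d :: nat. n \<ge> 2 \<and> d \<ge> 2 \<longrightarrow> tickets 3 n d = {{}, {1}, {2}})"
proof (intro conjI allI impI)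
  let ?x = "\<lambda>a b. Poly_Mapping.single (0::nat) a + Poly_Mapping.single 1 (b::nat)"
  fix n d :: nat assume nd: "n \<ge> 2 \<and> d \<ge> 1"
  have "?x d 0 \<noteq> ?x 0 d" unfolding binary_monomial_eq_iff using nd by simp
  hence "triple (Poly_Mapping.single (?x d 0) 1) (Poly_Mapping.single (?x 0 d) 1)
      (Poly_Mapping.single (?x 0 d) 1) \<in> families 2 n d"
    using nd binary_monomial_in_form_monomials[of n d 0 d] binary_monomial_in_form_monomials[of n 0 d d]
    by (intro pair_in_families single_not_proportional) auto
  thus "tickets 2 n d = {{}}"
    unfolding tickets_def using ticket_2_empty by blast
next
  have "Poly_Mapping.single (0::nat) (1::nat) \<noteq> Poly_Mapping.single 1 1"
    using inj_var unfolding var_def by (metis injD zero_neq_one)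
  hence "{1} \<in> tickets 3 2 1"
    by (intro ticket_one_exists[OF pure_power_in_form_monomials pure_power_in_form_monomials]) auto
  thus "tickets 3 2 1 = {{1}}"
    using binary_linear_ticket_3 unfolding tickets_def by blast
next
  fix n :: nat assume n: "n \<ge> 3"
  have v: "var i \<in> form_monomials n 1" if "i < 3" for i
    using n that pure_power_in_form_monomials[of i n 1] by (simp add: var_def)
  have "{} \<in> tickets 3 n 1"
    using inj_var by (intro empty_ticket_exists[of "var 0" n 1 "var 1" "var 2"] v) (auto simp: inj_eq)
  moreover have "{1} \<in> tickets 3 n 1"
    using inj_var by (intro ticket_one_exists[of "var 0" n 1 "var 1"] v) (auto simp: inj_eq)
  moreover have "tickets 3 n 1 \<subseteq> {{}, {1}}"
    unfolding tickets_def using linear_ticket_3_cases by blast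
  ultimately show "tickets 3 n 1 = {{}, {1}}" by blast
next
  fix n d :: nat assume nd: "n \<ge> 2 \<and> d \<ge> 2"
  let ?x = "\<lambda>a b. Poly_Mapping.single (0::nat) a + Poly_Mapping.single 1 (b::nat)"
  \<comment> \<open>These are \<open>x^d\<close>, \<open>x^(d-1) y\<close> and \<open>x^(d-2) y^2\<close>, whose exponents are in arithmetic
    progression.\<close>
  let ?k = "?x d 0" and ?l = "?x (d - 1) 1" and ?j = "?x (d - 2) 2"
  have mono: "?k \<in> form_monomials n d" "?l \<in> form_monomials n d" "?j \<in> form_monomials n d"
    using nd by (intro binary_monomial_in_form_monomials; linarith)+
  have dist: "?k \<noteq> ?l" "?l \<noteq> ?j" "?j \<noteq> ?k"
    unfolding binary_monomial_eq_iff by simp_all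
  have "?k + ?j = ?x (d + (d - 2)) (0 + 2)" "?l + ?l = ?x ((d - 1) + (d - 1)) (1 + 1)"
    unfolding single_add by (simp_all only: ac_simps)
  moreover have "d + (d - 2) = (d - 1) + (d - 1)" using nd by linarith
  ultimately have "?k + ?j = ?l + ?l" by (simp only: add_0 one_add_one)
  hence "{2} \<in> tickets 3 n d" using mono dist by (intro ticket_two_exists)
  moreover have "{} \<in> tickets 3 n d" using mono dist by (intro empty_ticket_exists)
  moreover have "{1} \<in> tickets 3 n d" using mono dist by (intro ticket_one_exists)
  moreover have "tickets 3 n d \<subseteq> {{}, {1}, {2}}"
    unfolding tickets_def using ticket_3_cases by blast
  ultimately show "tickets 3 n d = {{}, {1}, {2}}" by blast
qed

end
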